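(* Let $m,n$ be positive integers, let $A$ and $B$ be $m\times n$ matrices, let $X$ be an $n\times n$ matrix, and let $\mathcal J=(1)_{1\le i,j\le n}$ be the $n\times n$ all-ones matrix. (Even case) If $m$ is even, then $$\det\bigl(AXB^t+B(\mathcal J-X^t)A^t\bigr)=f_{A,B}(X)\,f_{B,A}(\mathcal J-X^t),$$ where, for $m\times n$ matrices $A,B$ and an $n\times n$ matrix $X$, $$f_{A,B}(X)=\sum_{\substack{I,J\subseteq[n]\\ |I|=|J|=m/2}}\det (X_{I,J})\,\det(A^IB^J).$$ (Odd case) If $m$ is odd, then $$\det\bigl(AXB^t+B(\mathcal J-X^t)A^t\bigr)=g_{A,B}(X)\,g_{B,A}(\mathcal J-X^t)=(-1)^{(m-1)/2}g_{A,B}(X)\,g_{B,A}(X^t),$$ where $$g_{A,B}(X)=\sum_{\substack{I,J\subseteq[n]\\ |I|=(m+1)/2,\ |J|=(m-1)/2}}\det\bigl(\mathbf 1\; X_{I,J}\bigr)\,\det(A^IB^J),$$ and $\mathbf 1$ denotes a column of length $(m+1)/2$ consisting entirely of $1$'s.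
   Context: All matrices have entries in a commutative ring with unit. $[n]=\{1,\dots,n\}$. $X_{I,J}$ is the submatrix of $X$ consisting of the rows indexed by $I$ and columns indexed by $J$ (in increasing order). $A^I$ is the submatrix of $A$ consisting of the columns indexed by $I$ (in increasing order), similarly $B^J$. $A^IB^J$ denotes the concatenation (side by side, $A^I$ first) of $A^I$ and $B^J$, which is an $m\times m$ matrix here; it is not a matrix product. Likewise $(\mathbf 1\;X_{I,J})$ is the square matrix obtained by prepending the column $\mathbf 1$ to $X_{I,J}$. The determinant of a $0\times0$ matrix is $1$. $f_{B,A}$ and $g_{B,A}$ are obtained by exchanging the roles of $A$ and $B$ in the definitions. *)

theory Defs
  imports
    "Jordan_Normal_Form.Determinant"
    "Jordan_Normal_Form.DL_Submatrix"
begin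

text \<open>
  Matrices of \<^theory>\<open>Jordan_Normal_Form.Matrix\<close> are indexed from \<open>0\<close>, so the index set
  \<open>[n]\<close> is rendered as \<open>{0..<n}\<close>.
  The library's \<^const>\<open>submatrix\<close> lists the selected rows and columns in increasing order, and
  \<open>submatrix A UNIV I\<close> keeps all rows.
\<close>

definition append_cols :: "'a::zero mat \<Rightarrow> 'a mat \<Rightarrow> 'a mat" where
  "append_cols A B = four_block_mat A B (0\<^sub>m 0 (dim_col A)) (0\<^sub>m 0 (dim_col B))"

definition all_ones_mat :: "nat \<Rightarrow> nat \<Rightarrow> 'a::one mat" where
  "all_ones_mat r c = mat r c (\<lambda>_. 1)"

definition index_pairs :: "nat \<Rightarrow> nat \<Rightarrow> nat \<Rightarrow> (nat set \<times> nat set) set" where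
  "index_pairs n p q = {(I, J). I \<subseteq> {0..<n} \<and> J \<subseteq> {0..<n} \<and> card I = p \<and> card J = q}"

text \<open>
  The following two functions are meant for \<open>A\<close>, \<open>B\<close> of dimension \<open>m \<times> n\<close> and \<open>X\<close> of
  dimension \<open>n \<times> n\<close>, with \<open>m\<close> even in the first and \<open>m\<close> odd in the second, so that all
  divisions by \<open>2\<close> are exact and all determinants are of square matrices.
\<close>

definition f_sum :: "'a::comm_ring_1 mat \<Rightarrow> 'a mat \<Rightarrow> 'a mat \<Rightarrow> 'a" where
  "f_sum A B X =
    (let m = dim_row A; n = dim_col A in
      \<Sum>(I, J)\<in>index_pairs n (m div 2) (m div 2).
        det (submatrix X I J) * det (append_cols (submatrix A UNIV I) (submatrix B UNIV J)))"

definition g_sum :: "'a::comm_ring_1 mat \<Rightarrow> 'a mat \<Rightarrow> 'a mat \<Rightarrow> 'a" where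
  "g_sum A B X =
    (let m = dim_row A; n = dim_col A in
      \<Sum>(I, J)\<in>index_pairs n ((m + 1) div 2) ((m - 1) div 2).
        det (append_cols (all_ones_mat ((m + 1) div 2) 1) (submatrix X I J)) *
        det (append_cols (submatrix A UNIV I) (submatrix B UNIV J)))"

end

theory Submission
  imports Defs
begin

text \<open>
  Write \<open>a\<^sub>i\<close>, \<open>b\<^sub>j\<close> for the columns of \<open>A\<close>, \<open>B\<close>, write \<open>Z = \<J> - X\<^sup>t\<close>, and let \<open>u = \<Sum> a\<^sub>i\<close> and
  \<open>v = \<Sum> b\<^sub>j\<close> be the vectors of row sums. The proof is a computation in an exterior algebra.
  A list of pairs of vectors \<open>(c\<^sub>1, b\<^sub>1), (c\<^sub>2, b\<^sub>2), \<dots>\<close> stands for the form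
  \<open>\<omega> = \<Sum> c\<^sub>j \<and> b\<^sub>j\<close>. As \<open>(c \<and> b)\<^sup>2 = 0\<close>, its exponential is the finite product
  \<open>\<Prod> (1 + c\<^sub>j \<and> b\<^sub>j)\<close>, which needs no division and so makes sense over every commutative ring.
  The exterior algebra itself is avoided: \<open>pairsum F L\<close> is the value on this product of the
  linear functional given by an alternating multilinear function \<open>F\<close>. What makes
  the method work is that it depends on the form only (\<open>pairsum_tensor\<close> and \<open>pairsum_flip\<close>).

  By the Cauchy-Binet formula, \<open>f\<^bsub>A,B\<^esub>(X)\<close> and \<open>g\<^bsub>A,B\<^esub>(X)\<close> are, up to a sign, the top coefficients
  of \<open>exp(\<omega>)\<close> and of \<open>u \<and> exp(\<omega>)\<close> for \<open>\<omega> = \<Sum> x\<^sub>i\<^sub>j a\<^sub>i \<and> b\<^sub>j\<close>. They are thus Pfaffians in disguise.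

  The determinant is evaluated in \<open>R\<^sup>m \<oplus> R\<^sup>m\<close>, with the three embeddings \<open>\<iota> w = (w, 0)\<close>,
  \<open>\<kappa> w = (0, w)\<close> and \<open>\<delta> w = (w, w)\<close>. The form
  \<open>\<Sum> x\<^sub>i\<^sub>j \<delta> b\<^sub>j \<and> \<kappa> a\<^sub>i + \<Sum> z\<^sub>j\<^sub>i \<delta> a\<^sub>i \<and> \<kappa> b\<^sub>j\<close> pairs the diagonal with the second
  summand, and the top coefficient of its exponential is, up to a sign, the determinant in question.
  Adding \<open>\<Sum> x\<^sub>i\<^sub>j \<delta> a\<^sub>i \<and> \<delta> b\<^sub>j\<close> changes nothing, because each new term that enters a product of
  degree \<open>2m\<close> brings in more than \<open>m\<close> vectors of the diagonal. Since \<open>\<delta> = \<iota> + \<kappa>\<close> and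
  \<open>x\<^sub>i\<^sub>j + z\<^sub>j\<^sub>i = 1\<close>, the enlarged form equals
  \<open>\<Sum> x\<^sub>i\<^sub>j \<iota> a\<^sub>i \<and> \<iota> b\<^sub>j + \<iota> u \<and> \<kappa> v + \<Sum> z\<^sub>j\<^sub>i \<kappa> a\<^sub>i \<and> \<kappa> b\<^sub>j\<close>.
  The outer sums live in different summands of \<open>R\<^sup>m \<oplus> R\<^sup>m\<close> and are linked only by the middle
  term, whose exponential is \<open>1 + \<iota> u \<and> \<kappa> v\<close>. Hence the top coefficient is a sum of two products
  (\<open>det_eq_sum_products\<close>). The first one needs \<open>m\<close> vectors of each summand in pairs and
  vanishes for odd \<open>m\<close>; the second one has an additional \<open>u\<close> and \<open>v\<close> and vanishes for even \<open>m\<close>. What is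
  left is the product of the two \<open>f\<close> or of the two \<open>g\<close>.

  For the last equation, the columns of \<open>B Z\<close> are \<open>v\<close> minus the columns of \<open>B X\<^sup>t\<close>, and the
  factor \<open>v\<close> in front of the exponential cancels each of these \<open>v\<close>; only signs remain.
\<close>

section \<open>Alternating multilinear functions of lists of vectors\<close>

text \<open>
  Vectors are functions on \<open>nat\<close> of which only the first \<open>N\<close> values count. This spares all
  dimension side conditions when vectors are added, scaled or embedded. The length of the list is
  left free, so that fixing some entries of an alternating function gives an alternating function again.
\<close>

definition alternating :: "nat \<Rightarrow> ((nat \<Rightarrow> 'a::comm_ring_1) list \<Rightarrow> 'a) \<Rightarrow> bool" where
  "alternating N F \<longleftrightarrow>
    (\<forall>us x y ws. F (us @ (\<lambda>i. x i + y i) # ws) = F (us @ x # ws) + F (us @ y # ws)) \<and>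
    (\<forall>us c x ws. F (us @ (\<lambda>i. c * x i) # ws) = c * F (us @ x # ws)) \<and>
    (\<forall>us x ws. F (us @ x # x # ws) = 0) \<and>
    (\<forall>us x y ws. (\<forall>i<N. x i = y i) \<longrightarrow> F (us @ x # ws) = F (us @ y # ws))"

definition unit_fun :: "nat \<Rightarrow> nat \<Rightarrow> 'a::comm_ring_1" where
  "unit_fun r = (\<lambda>i. if i = r then 1 else 0)"

lemma alternatingI:
  assumes "\<And>us x y ws. F (us @ (\<lambda>i. x i + y i) # ws) = F (us @ x # ws) + F (us @ y # ws)"
    and "\<And>us c x ws. F (us @ (\<lambda>i. c * x i) # ws) = c * F (us @ x # ws)"
    and "\<And>us x ws. F (us @ x # x # ws) = 0"
    and "\<And>us x y ws. (\<And>i. i < N \<Longrightarrow> x i = y i) \<Longrightarrow> F (us @ x # ws) = F (us @ y # ws)"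
  shows "alternating N F"
  unfolding alternating_def using assms by blast

context
  fixes N :: nat and F :: "(nat \<Rightarrow> 'a::comm_ring_1) list \<Rightarrow> 'a"
  assumes F: "alternating N F"
begin

lemma alternating_add: "F (us @ (\<lambda>i. x i + y i) # ws) = F (us @ x # ws) + F (us @ y # ws)"
  and alternating_smult: "F (us @ (\<lambda>i. c * x i) # ws) = c * F (us @ x # ws)"
  and alternating_adjacent: "F (us @ x # x # ws) = 0"
  using F unfolding alternating_def by blast+

lemma alternating_cong: "(\<And>i. i < N \<Longrightarrow> x i = y i) \<Longrightarrow> F (us @ x # ws) = F (us @ y # ws)"
  using F unfolding alternating_def by blast

lemma alternating_zero: "F (us @ (\<lambda>i. 0) # ws) = 0"
  using alternating_smult[of us 0 "\<lambda>i. 0" ws] by simp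

lemma alternating_uminus: "F (us @ (\<lambda>i. - x i) # ws) = - F (us @ x # ws)"
  using alternating_smult[of us "-1" x ws] by simp

lemma alternating_swap: "F (us @ x # y # ws) = - F (us @ y # x # ws)"
proof -
  let ?s = "\<lambda>i. x i + y i"
  have "0 = F (us @ ?s # ?s # ws)" by (simp add: alternating_adjacent)
  also have "\<dots> = F (us @ x # ?s # ws) + F (us @ y # ?s # ws)" by (rule alternating_add)
  also have "F (us @ x # ?s # ws) = F (us @ x # y # ws)"
    using alternating_add[of "us @ [x]" x y ws] by (simp add: alternating_adjacent)
  also have "F (us @ y # ?s # ws) = F (us @ y # x # ws)"
    using alternating_add[of "us @ [y]" x y ws] by (simp add: alternating_adjacent)
  finally show ?thesis by (simp add: eq_neg_iff_add_eq_0)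
qed

lemma alternating_move: "F (us @ x # vs @ ws) = (-1) ^ length vs * F (us @ vs @ x # ws)"
proof (induction vs arbitrary: us)
  case (Cons v vs)
  have "F (us @ x # (v # vs) @ ws) = - F ((us @ [v]) @ x # vs @ ws)"
    using alternating_swap[of us x v "vs @ ws"] by simp
  also have "\<dots> = - ((-1) ^ length vs * F ((us @ [v]) @ vs @ x # ws))" by (simp only: Cons.IH)
  finally show ?case by simp
qed simp

lemma alternating_repeat: "F (us @ x # vs @ x # ws) = 0"
proof -
  have "F (us @ x # vs @ (x # ws)) = (-1) ^ length vs * F (us @ vs @ x # x # ws)"
    by (rule alternating_move)
  also have "F (us @ vs @ x # x # ws) = 0" using alternating_adjacent[of "us @ vs"] by simp
  finally show ?thesis by simp
qed

lemma alternating_not_distinct: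
  assumes "\<not> distinct is" shows "F (map e is) = 0"
proof -
  obtain xs y ys zs where "is = xs @ [y] @ ys @ [y] @ zs" using not_distinct_decomp[OF assms] by blast
  then show ?thesis by (simp add: alternating_repeat)
qed

text \<open>
  Permuting the arguments changes only the sign, so vanishing is invariant; in this form no
  sign of a permutation has to be computed.
\<close>

lemma alternating_perm_zero:
  assumes "mset is = mset js" and "F (us @ map e js) = 0"
  shows "F (us @ map e is) = 0"
  using assms
proof (induction js arbitrary: "is" us)
  case (Cons j js)
  then have "j \<in> set is" by (metis list.set_intros(1) set_mset_mset)
  then obtain ps qs where ps: "is = ps @ j # qs" by (meson split_list)
  then have "mset (ps @ qs) = mset js" using Cons.prems(1) by simp
  moreover have "F ((us @ [e j]) @ map e js) = 0" using Cons.prems(2) by simp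
  ultimately have "F ((us @ [e j]) @ map e (ps @ qs)) = 0" by (rule Cons.IH)
  then have "F (us @ e j # map e ps @ map e qs) = 0" by simp
  then have "(-1) ^ length ps * F (us @ map e ps @ e j # map e qs) = 0"
    using alternating_move[of us "e j" "map e ps" "map e qs"] by simp
  then have "(-1) ^ length ps * ((-1) ^ length ps * F (us @ map e ps @ e j # map e qs)) = 0"
    by (simp only: mult_zero_right)
  then show ?case using ps by simp
qed simp

lemma alternating_sum:
  assumes "finite A"
  shows "F (us @ (\<lambda>i. \<Sum>a\<in>A. g a i) # ws) = (\<Sum>a\<in>A. F (us @ g a # ws))"
  using assms by induction (simp_all add: alternating_zero alternating_add)

lemma alternating_expand: "F (us @ v # ws) = (\<Sum>r<N. v r * F (us @ unit_fun r # ws))"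
proof -
  have "F (us @ v # ws) = F (us @ (\<lambda>i. \<Sum>r<N. v r * unit_fun r i) # ws)"
    by (rule alternating_cong) (simp add: unit_fun_def if_distrib[of "(*) _"] cong: if_cong)
  then show ?thesis by (simp add: alternating_sum alternating_smult)
qed

text \<open>
  Expansion into unit vectors leaves lists of at least \<open>N\<close> unit vectors out of \<open>N\<close>. Such a list has a
  repetition or is a permutation of the basis. Covering lists longer than \<open>N\<close> as well is what makes block
  determinants with blocks of the wrong shape vanish below.
\<close>

lemma alternating_vanishes:
  assumes basis: "F (map unit_fun [0..<N]) = 0" and "length vs \<ge> N"
  shows "F vs = 0"
proof -
  have "F (map unit_fun is @ ws) = 0"
    if "set is \<subseteq> {..<N}" "length is + length ws = length vs" for "is" ws
    using that
  proof (induction ws arbitrary: "is")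
    case Nil
    show ?case
    proof (cases "distinct is")
      case True
      then have "card (set is) \<ge> card {..<N}" using Nil assms(2) by (simp add: distinct_card)
      then have "set is = {..<N}" using Nil.prems(1) by (intro card_seteq) auto
      then have "set is = set [0..<N]" by (simp add: atLeast0LessThan)
      then have "mset is = mset [0..<N]"
        using set_eq_iff_mset_eq_distinct[OF True distinct_upt] by blast
      then show ?thesis using alternating_perm_zero[of "is" "[0..<N]" "[]"] basis by simp
    qed (simp add: alternating_not_distinct)
  next
    case (Cons w ws)
    have "F (map unit_fun is @ unit_fun r # ws) = 0" if "r < N" for r
      using Cons.IH[of "is @ [r]"] Cons.prems that by simp
    then show ?case unfolding alternating_expand[of _ w] by (intro sum.neutral) simp
  qed
  from this[of "[]" vs] show ?thesis by simp
qed

lemma alternating_context: "alternating N (\<lambda>vs. F (us @ vs @ ws))"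
proof (rule alternatingI, goal_cases)
  case (1 vs x y zs)
  then show ?case using alternating_add[of "us @ vs" x y "zs @ ws"] by simp
next
  case (2 vs c x zs)
  then show ?case using alternating_smult[of "us @ vs" c x "zs @ ws"] by simp
next
  case (3 vs x zs)
  then show ?case using alternating_adjacent[of "us @ vs" x "zs @ ws"] by simp
next
  case (4 vs x y zs)
  then show ?case using alternating_cong[of x y "us @ vs" "zs @ ws"] by simp
qed

lemma alternating_Cons2: "alternating N (\<lambda>vs. F (x # y # vs))"
  using alternating_context[of "[x, y]" "[]"] by simp

lemma alternating_scale: "alternating N (\<lambda>vs. F vs * c)"
proof (rule alternatingI, goal_cases)
  case (4 us x y ws)
  then show ?case using alternating_cong[of x y us ws] by simp
qed (simp_all add: alternating_add alternating_smult alternating_adjacent algebra_simps)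

end

lemma alternating_diff:
  assumes "alternating N F" "alternating N G"
  shows "alternating N (\<lambda>vs. F vs - G vs)"
proof (rule alternatingI, goal_cases)
  case (4 us x y ws)
  then show ?case using alternating_cong[OF assms(1), of x y us ws] alternating_cong[OF assms(2), of x y us ws] by simp
qed (simp_all add: alternating_add[OF assms(1)] alternating_add[OF assms(2)]
    alternating_smult[OF assms(1)] alternating_smult[OF assms(2)]
    alternating_adjacent[OF assms(1)] alternating_adjacent[OF assms(2)] algebra_simps)

section \<open>The determinant of a list of vectors\<close>

text \<open>
  The value \<open>0\<close> for lists of the wrong length plays the part of extracting the component of degree \<open>N\<close>:
  it lets a pair sum run over sublists of every length.
\<close>

definition vdet :: "nat \<Rightarrow> (nat \<Rightarrow> 'a::comm_ring_1) list \<Rightarrow> 'a" where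
  "vdet N vs = (if length vs = N then det (mat N N (\<lambda>(i, j). (vs ! j) i)) else 0)"

lemma vdet_length: "length vs \<noteq> N \<Longrightarrow> vdet N vs = 0"
  by (simp add: vdet_def)

lemma vdet_transpose:
  assumes "length vs = N" shows "vdet N vs = det (mat N N (\<lambda>(i, j). (vs ! i) j))"
proof -
  have "(mat N N (\<lambda>(i, j). (vs ! j) i))\<^sup>T = mat N N (\<lambda>(i, j). (vs ! i) j)" by (rule eq_matI) auto
  then show ?thesis using det_transpose[of "mat N N (\<lambda>(i, j). (vs ! j) i)" N] assms
    by (simp add: vdet_def)
qed

text \<open>
  This is the Laplace expansion along one column; the cofactors do not involve that column, which
  is all that multilinearity requires.
\<close>

lemma vdet_expand:
  "\<exists>C. \<forall>v. vdet N (us @ v # ws) = (\<Sum>i<N. v i * C i)"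
proof (cases "length us + Suc (length ws) = N")
  case True
  let ?j = "length us"
  let ?M = "\<lambda>v. mat N N (\<lambda>(i, j). ((us @ v # ws) ! j) i)"
  have del: "mat_delete (?M v) i ?j = mat_delete (?M w) i ?j" for i v w
    by (rule eq_matI) (use True in \<open>auto simp: mat_delete_def nth_append\<close>)
  have "det (?M v) = (\<Sum>i<N. v i * cofactor (?M (\<lambda>_. 0)) i ?j)" for v
    using laplace_expansion_column[of "?M v" N ?j] del[of v _ "\<lambda>_. 0"] True
    by (simp add: cofactor_def)
  then show ?thesis using True by (auto simp: vdet_def)
next
  case False
  then show ?thesis by (auto simp: vdet_def intro!: exI[of _ "\<lambda>_. 0"])
qed

lemma alternating_vdet: "alternating N (vdet N)"
proof (rule alternatingI, goal_cases)
  case (1 us x y ws)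
  obtain C where "\<And>v. vdet N (us @ v # ws) = (\<Sum>i<N. v i * C i)" using vdet_expand by blast
  then show ?case by (simp add: distrib_right sum.distrib)
next
  case (2 us c x ws)
  obtain C where "\<And>v. vdet N (us @ v # ws) = (\<Sum>i<N. v i * C i)" using vdet_expand by blast
  then show ?case by (simp add: sum_distrib_left mult.assoc)
next
  case (3 us x ws)
  show ?case
  proof (cases "length us + Suc (Suc (length ws)) = N")
    case True
    let ?M = "mat N N (\<lambda>(i, j). ((us @ x # x # ws) ! j) i)"
    have "det ?M = 0"
      by (rule det_identical_columns[of _ N "length us" "Suc (length us)"])
        (use True in \<open>auto simp: nth_append\<close>)
    then show ?thesis by (simp add: vdet_def)
  qed (simp add: vdet_def)
next
  case (4 us x y ws)
  obtain C where "\<And>v. vdet N (us @ v # ws) = (\<Sum>i<N. v i * C i)" using vdet_expand by blast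
  then show ?case using 4 by simp
qed

lemma vdet_unit_funs: "vdet N (map unit_fun [0..<N]) = 1"
proof -
  have "mat N N (\<lambda>(i, j). (map unit_fun [0..<N] ! j) i) = (1\<^sub>m N :: 'a mat)"
    by (rule eq_matI) (auto simp: unit_fun_def)
  then show ?thesis by (simp add: vdet_def)
qed

text \<open>
  The determinant is the only alternating function up to a scalar: the difference of the two
  sides vanishes on the basis.
\<close>

lemma alternating_unique:
  assumes "alternating N F" and "length vs \<ge> N"
  shows "F vs = vdet N vs * F (map unit_fun [0..<N])"
proof -
  let ?c = "F (map unit_fun [0..<N])"
  have "alternating N (\<lambda>vs. F vs - vdet N vs * ?c)"
    by (intro alternating_diff alternating_scale assms(1) alternating_vdet)
  from alternating_vanishes[OF this _ assms(2)] show ?thesis by (simp add: vdet_unit_funs)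
qed

text \<open>
  The last clause says that \<open>\<phi>\<close> induces a linear map \<open>R\<^sup>a \<rightarrow> R\<^sup>N\<close> on the coordinates that count.
\<close>

definition linear_fun :: "nat \<Rightarrow> nat \<Rightarrow> ((nat \<Rightarrow> 'a::comm_ring_1) \<Rightarrow> nat \<Rightarrow> 'a) \<Rightarrow> bool" where
  "linear_fun a N \<phi> \<longleftrightarrow>
    (\<forall>x y. \<phi> (\<lambda>i. x i + y i) = (\<lambda>i. \<phi> x i + \<phi> y i)) \<and>
    (\<forall>c x. \<phi> (\<lambda>i. c * x i) = (\<lambda>i. c * \<phi> x i)) \<and>
    (\<forall>x y. (\<forall>i<a. x i = y i) \<longrightarrow> (\<forall>i<N. \<phi> x i = \<phi> y i))"

lemma alternating_map:
  assumes F: "alternating N F" and \<phi>: "linear_fun a N \<phi>"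
  shows "alternating a (\<lambda>vs. F (map \<phi> vs))"
proof -
  have lin: "\<phi> (\<lambda>i. x i + y i) = (\<lambda>i. \<phi> x i + \<phi> y i)" "\<phi> (\<lambda>i. c * x i) = (\<lambda>i. c * \<phi> x i)"
    and loc: "(\<And>i. i < a \<Longrightarrow> x i = y i) \<Longrightarrow> i < N \<Longrightarrow> \<phi> x i = \<phi> y i" for x y c i
    using \<phi> unfolding linear_fun_def by blast+
  show ?thesis
  proof (rule alternatingI, goal_cases)
    case (4 us x y ws)
    then have "F (map \<phi> us @ \<phi> x # map \<phi> ws) = F (map \<phi> us @ \<phi> y # map \<phi> ws)"
      by (intro alternating_cong[OF F] loc)
    then show ?case by simp
  qed (simp_all add: lin alternating_add[OF F] alternating_smult[OF F] alternating_adjacent[OF F])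
qed

text \<open>
  As a function of either list the left-hand side is alternating, in \<open>a\<close> and in \<open>b\<close>
  coordinates respectively, so it is a multiple of the corresponding determinant. The lengths of the lists
  are arbitrary: if one list has more vectors than coordinates, then both sides are zero.
\<close>

lemma vdet_block:
  assumes \<phi>: "linear_fun a (a + b) \<phi>" and \<psi>: "linear_fun b (a + b) \<psi>"
    and basis: "vdet (a + b) (map \<phi> (map unit_fun [0..<a]) @ map \<psi> (map unit_fun [0..<b])) = 1"
  shows "vdet (a + b) (map \<phi> us @ map \<psi> vs) = vdet a us * vdet b vs"
proof -
  let ?F = "\<lambda>us vs. vdet (a + b) (map \<phi> us @ map \<psi> vs)"
  have left: "alternating a (\<lambda>us. ?F us vs)" for vs
    using alternating_map[OF alternating_context[OF alternating_vdet, of _ "[]" "map \<psi> vs"] \<phi>] by simp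
  have right: "alternating b (?F us)" for us
    using alternating_map[OF alternating_context[OF alternating_vdet, of _ "map \<phi> us" "[]"] \<psi>] by simp
  let ?ea = "map unit_fun [0..<a] :: (nat \<Rightarrow> 'a) list"
  let ?eb = "map unit_fun [0..<b] :: (nat \<Rightarrow> 'a) list"
  consider "length us + length vs \<noteq> a + b" | "length us = a" "length vs = b"
    | "length us > a" | "length vs > b" by linarith
  then show ?thesis
  proof cases
    case 2
    have "?F us vs = vdet a us * ?F ?ea vs"
      using alternating_unique[OF left[of vs], of us] 2 by simp
    also have "?F ?ea vs = vdet b vs * ?F ?ea ?eb"
      using alternating_unique[OF right[of ?ea], of vs] 2 by simp
    finally show ?thesis using basis by simp
  next
    case 3
    then show ?thesis using alternating_unique[OF left[of vs], of us] by (simp add: vdet_length)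
  next
    case 4
    then show ?thesis using alternating_unique[OF right[of us], of vs] by (simp add: vdet_length)
  next
    case 1
    then have "vdet a us = 0 \<or> vdet b vs = 0" by (auto simp: vdet_def)
    then show ?thesis using 1 by (auto simp: vdet_length)
  qed
qed

definition embed_fst :: "nat \<Rightarrow> (nat \<Rightarrow> 'a::comm_ring_1) \<Rightarrow> nat \<Rightarrow> 'a" where
  "embed_fst a x = (\<lambda>i. if i < a then x i else 0)"

definition embed_snd :: "nat \<Rightarrow> (nat \<Rightarrow> 'a::comm_ring_1) \<Rightarrow> nat \<Rightarrow> 'a" where
  "embed_snd a x = (\<lambda>i. if i < a then 0 else x (i - a))"

definition embed_diag :: "nat \<Rightarrow> (nat \<Rightarrow> 'a::comm_ring_1) \<Rightarrow> nat \<Rightarrow> 'a" where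
  "embed_diag a x = (\<lambda>i. if i < a then x i else x (i - a))"

lemma linear_embed_fst: "linear_fun a (a + b) (embed_fst a)"
  unfolding linear_fun_def embed_fst_def by (intro conjI allI impI ext) simp_all

lemma linear_embed_snd: "linear_fun b (a + b) (embed_snd a)"
  unfolding linear_fun_def embed_snd_def by (intro conjI allI impI ext) simp_all

lemma linear_embed_diag: "linear_fun a (a + a) (embed_diag a)"
  unfolding linear_fun_def embed_diag_def by (intro conjI allI impI ext) simp_all

lemma vdet_unitriangular:
  assumes "length vs = N" and "\<And>j. j < N \<Longrightarrow> (vs ! j) j = 1"
    and "\<And>i j. i < j \<Longrightarrow> j < N \<Longrightarrow> (vs ! j) i = 0"
  shows "vdet N vs = 1"
proof -
  have "det (mat N N (\<lambda>(i, j). (vs ! j) i)) = prod_list (diag_mat (mat N N (\<lambda>(i, j). (vs ! j) i)))"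
    by (rule det_lower_triangular[of N]) (use assms in auto)
  also have "\<dots> = 1" unfolding prod_list_diag_prod by (rule prod.neutral) (use assms in auto)
  finally show ?thesis using assms(1) by (simp add: vdet_def)
qed

lemma vdet_embed_fst_snd: "vdet (a + b) (map (embed_fst a) us @ map (embed_snd a) vs) = vdet a us * vdet b vs"
  by (rule vdet_block[OF linear_embed_fst linear_embed_snd], rule vdet_unitriangular)
    (auto simp: nth_append embed_fst_def embed_snd_def unit_fun_def)

lemma vdet_embed_diag_snd: "vdet (a + a) (map (embed_diag a) us @ map (embed_snd a) vs) = vdet a us * vdet a vs"
  by (rule vdet_block[OF linear_embed_diag linear_embed_snd], rule vdet_unitriangular)
    (auto simp: nth_append embed_diag_def embed_snd_def unit_fun_def)

section \<open>Sums over sublists of a list of pairs\<close>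

text \<open>
  This is \<open>F\<close> applied to the expansion of \<open>\<Prod> (1 + c\<^sub>j \<and> b\<^sub>j)\<close>, which is the exponential of
  \<open>\<Sum> c\<^sub>j \<and> b\<^sub>j\<close>: each pair is either skipped or contributes its two vectors in order.
\<close>

fun pairsum :: "('v list \<Rightarrow> 'a::comm_ring_1) \<Rightarrow> ('v \<times> 'v) list \<Rightarrow> 'a" where
  "pairsum F [] = F []"
| "pairsum F ((c, b) # L) = pairsum F L + pairsum (\<lambda>vs. F (c # b # vs)) L"

lemma pairsum_cong_even:
  "(\<And>vs. even (length vs) \<Longrightarrow> F vs = G vs) \<Longrightarrow> pairsum F L = pairsum G L"
proof (induction L arbitrary: F G)
  case (Cons p L)
  obtain c b where p: "p = (c, b)" by (cases p)
  have "pairsum F L = pairsum G L" by (rule Cons.IH) (rule Cons.prems)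
  moreover have "pairsum (\<lambda>vs. F (c # b # vs)) L = pairsum (\<lambda>vs. G (c # b # vs)) L"
    by (rule Cons.IH) (simp add: Cons.prems)
  ultimately show ?case by (simp add: p)
qed simp

lemma pairsum_0: "pairsum (\<lambda>vs. 0) L = 0"
  by (induction L) auto

lemma pairsum_odd:
  assumes "\<And>vs. even (length vs) \<Longrightarrow> F vs = 0"
  shows "pairsum F L = 0"
  using pairsum_cong_even[of F "\<lambda>vs. 0" L] assms by (simp add: pairsum_0)

lemma pairsum_add: "pairsum (\<lambda>vs. F vs + G vs) L = pairsum F L + pairsum G L"
  by (induction L arbitrary: F G) (auto simp: algebra_simps)

lemma pairsum_cmult: "pairsum (\<lambda>vs. c * F vs) L = c * pairsum F L"
  by (induction L arbitrary: F) (auto simp: algebra_simps)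

lemma pairsum_append:
  "pairsum F (K @ L) = pairsum (\<lambda>us. pairsum (\<lambda>vs. F (us @ vs)) L) K"
  by (induction K arbitrary: F) auto

lemma pairsum_map: "pairsum F (map (map_prod \<phi> \<phi>) L) = pairsum (\<lambda>vs. F (map \<phi> vs)) L"
  by (induction L arbitrary: F) auto

text \<open>
  Used where the number of vectors is already exhausted, so that a further factor has no effect.
\<close>

lemma pairsum_Nil_only:
  assumes "\<And>vs. vs \<noteq> [] \<Longrightarrow> F vs = 0"
  shows "pairsum F L = F []"
  using assms
proof (induction L)
  case (Cons p L)
  have "pairsum (\<lambda>vs. F (fst p # snd p # vs)) L = 0"
    using Cons.prems by (intro pairsum_odd) simp
  moreover have "pairsum F L = F []" using Cons by blast
  ultimately show ?case by (cases p) simp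
qed simp

subsection \<open>Moves that preserve the sum\<close>

text \<open>
  The map \<open>(c, b) \<mapsto> 1 + c \<and> b\<close> turns sums in either component into products, since the cross terms
  contain a repeated vector, and its values commute.
\<close>

context
  fixes N :: nat and F :: "(nat \<Rightarrow> 'a::comm_ring_1) list \<Rightarrow> 'a"
  assumes F: "alternating N F"
begin

lemma pairsum_split_fst:
  "pairsum F ((\<lambda>i. x i + y i, b) # L) = pairsum F ((x, b) # (y, b) # L)"
  using alternating_add[OF F, of "[]" x y] alternating_repeat[OF F, of "[x]" b "[y]"]
  by (simp add: pairsum_add pairsum_0)

lemma pairsum_merge_snd:
  "pairsum F ((c, x) # (c, y) # L) = pairsum F ((c, \<lambda>i. x i + y i) # L)"
  using alternating_add[OF F, of "[c]" x y] alternating_repeat[OF F, of "[]" c "[x]"]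
  by (simp add: pairsum_add pairsum_0)

lemma pairsum_scale:
  "pairsum F ((\<lambda>i. s * x i, b) # L) = pairsum F ((x, \<lambda>i. s * b i) # L)"
  using alternating_smult[OF F, of "[]" s x] alternating_smult[OF F, of "[x]" s b]
  by simp

lemma pairsum_swap: "pairsum F ((c, b) # (x, y) # L) = pairsum F ((x, y) # (c, b) # L)"
proof -
  have "F (c # b # x # y # vs) = F (x # y # c # b # vs)" for vs
    using alternating_move[OF F, of "[c]" b "[x, y]" vs] alternating_move[OF F, of "[]" c "[x, y]" "b # vs"]
    by simp
  then show ?thesis by simp
qed

lemma pairsum_zero_fst: "pairsum F ((\<lambda>i. 0, b) # L) = pairsum F L"
  using alternating_zero[OF F, of "[]"] by (simp add: pairsum_0)

lemma pairsum_zero_snd: "pairsum F ((c, \<lambda>i. 0) # L) = pairsum F L"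
  using alternating_zero[OF F, of "[c]"] by (simp add: pairsum_0)

lemma pairsum_flip_Cons: "pairsum F ((\<lambda>i. - b i, c) # L) = pairsum F ((c, b) # L)"
  using alternating_uminus[OF F, of "[]" b] alternating_swap[OF F, of "[]" b c] by simp

lemma pairsum_cong_fst:
  assumes "\<And>i. i < N \<Longrightarrow> x i = y i"
  shows "pairsum F ((x, b) # L) = pairsum F ((y, b) # L)"
  using alternating_cong[OF F assms, where us = "[]"] by simp

lemma pairsum_cong_snd:
  assumes "\<And>i. i < N \<Longrightarrow> x i = y i"
  shows "pairsum F ((c, x) # L) = pairsum F ((c, y) # L)"
  using alternating_cong[OF F assms, where us = "[c]"] by simp

end

text \<open>
  Reversing only an initial part of the list expresses \<open>c \<and> b = - b \<and> c\<close> for chosen summands;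
  unlike the moves above, this alters the tensor \<open>\<Sum> c\<^sub>j \<otimes> b\<^sub>j\<close>.
\<close>

lemma pairsum_flip:
  assumes "alternating N F"
  shows "pairsum F (map (\<lambda>(c, b). (\<lambda>i. - b i, c)) K @ L) = pairsum F (K @ L)"
  using assms
proof (induction K arbitrary: F)
  case (Cons p K)
  obtain c b where p: "p = (c, b)" by (cases p)
  show ?case
    using pairsum_flip_Cons[OF Cons.prems, of b c] Cons.IH[OF Cons.prems]
      Cons.IH[OF alternating_Cons2[OF Cons.prems]]
    by (simp add: p)
qed simp

definition pair_tensor :: "((nat \<Rightarrow> 'a::comm_ring_1) \<times> (nat \<Rightarrow> 'a)) list \<Rightarrow> nat \<Rightarrow> nat \<Rightarrow> 'a" where
  "pair_tensor L p q = (\<Sum>(c, b)\<leftarrow>L. c p * b q)"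

lemma pairsum_unit_rows_cong:
  assumes "alternating N F" "\<And>r q. r \<in> set rs \<Longrightarrow> q < N \<Longrightarrow> T r q = T' r q"
  shows "pairsum F (map (\<lambda>r. (unit_fun r, T r)) rs) = pairsum F (map (\<lambda>r. (unit_fun r, T' r)) rs)"
  using assms
proof (induction rs arbitrary: F)
  case (Cons r rs)
  have "pairsum F ((unit_fun r, T r) # L) = pairsum F ((unit_fun r, T' r) # L)" for L
    using Cons.prems by (intro pairsum_cong_snd[OF Cons.prems(1)]) simp
  then show ?case
    using Cons.IH[OF Cons.prems(1)] Cons.IH[OF alternating_Cons2[OF Cons.prems(1)]] Cons.prems(2)
    by simp
qed simp

text \<open>
  Elimination step: \<open>c \<otimes> b\<close> is distributed over the rows \<open>e\<^sub>r \<otimes> T\<^sub>r\<close>, one coordinate of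
  \<open>c\<close> at a time. Restricting \<open>c\<close> to \<open>rs\<close> makes the induction on \<open>rs\<close> possible.
\<close>

lemma pairsum_absorb:
  assumes "alternating N F" and "distinct rs"
  shows "pairsum F ((\<lambda>i. if i \<in> set rs then c i else 0, b) # map (\<lambda>r. (unit_fun r, T r)) rs)
    = pairsum F (map (\<lambda>r. (unit_fun r, \<lambda>q. T r q + c r * b q)) rs)"
  using assms
proof (induction rs arbitrary: F)
  case Nil
  then show ?case using pairsum_zero_fst[of N F b "[]"] by simp
next
  case (Cons r rs)
  note F = Cons.prems(1)
  define x where "x = (\<lambda>i. if i \<in> set rs then c i else 0)"
  let ?L = "map (\<lambda>r. (unit_fun r, T r)) rs"
  let ?e = "unit_fun r :: nat \<Rightarrow> 'a"
  let ?t = "\<lambda>q. T r q + c r * b q"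
  have restrict: "(\<lambda>i. if i \<in> set (r # rs) then c i else 0) = (\<lambda>i. c r * ?e i + x i)"
    using Cons.prems(2) by (auto simp: x_def unit_fun_def fun_eq_iff)
  have "pairsum F ((\<lambda>i. c r * ?e i + x i, b) # (?e, T r) # ?L)
      = pairsum F ((\<lambda>i. c r * ?e i, b) # (x, b) # (?e, T r) # ?L)"
    by (rule pairsum_split_fst[OF F])
  also have "\<dots> = pairsum F ((?e, \<lambda>q. c r * b q) # (x, b) # (?e, T r) # ?L)"
    by (rule pairsum_scale[OF F])
  also have "\<dots> = pairsum F ((?e, \<lambda>q. c r * b q) # (?e, T r) # (x, b) # ?L)"
    using pairsum_swap[OF F, of x b ?e "T r" ?L]
      pairsum_swap[OF alternating_Cons2[OF F, of ?e "\<lambda>q. c r * b q"], of x b ?e "T r" ?L]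
    by (simp only: pairsum.simps(2))
  also have "\<dots> = pairsum F ((?e, \<lambda>q. c r * b q + T r q) # (x, b) # ?L)"
    by (rule pairsum_merge_snd[OF F])
  also have "(\<lambda>q. c r * b q + T r q) = ?t" by (simp add: add.commute)
  also have "pairsum F ((?e, ?t) # (x, b) # ?L)
      = pairsum F ((x, b) # ?L) + pairsum (\<lambda>vs. F (?e # ?t # vs)) ((x, b) # ?L)"
    by (rule pairsum.simps(2))
  also have "\<dots> = pairsum F ((?e, ?t) # map (\<lambda>r. (unit_fun r, \<lambda>q. T r q + c r * b q)) rs)"
    using Cons.IH[OF F, folded x_def] Cons.IH[OF alternating_Cons2[OF F, of ?e ?t], folded x_def]
      Cons.prems(2) by simp
  finally show ?case by (simp only: restrict list.map)
qed

text \<open>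
  Every list of pairs can be rewritten as the list of the unit vectors paired with the rows of its tensor.
\<close>

lemma pairsum_normal_form:
  assumes "alternating N F"
  shows "pairsum F L = pairsum F (map (\<lambda>r. (unit_fun r, pair_tensor L r)) [0..<N])"
  using assms
proof (induction L arbitrary: F)
  case Nil
  have "pairsum F (map (\<lambda>r. (unit_fun r, \<lambda>q. 0)) rs) = F []" for rs
    by (induction rs) (simp_all add: pairsum_zero_snd[OF Nil] del: pairsum.simps(2))
  then show ?case by (simp add: pair_tensor_def[abs_def])
next
  case (Cons p L)
  note F = Cons.prems
  obtain c b where p: "p = (c, b)" by (cases p)
  let ?L = "map (\<lambda>r. (unit_fun r, pair_tensor L r)) [0..<N]"
  have "pairsum F (p # L) = pairsum F ((c, b) # ?L)"
    using Cons.IH[OF F] Cons.IH[OF alternating_Cons2[OF F]] by (simp add: p)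
  also have "\<dots> = pairsum F ((\<lambda>i. if i \<in> set [0..<N] then c i else 0, b) # ?L)"
    by (rule pairsum_cong_fst[OF F]) simp
  also have "\<dots> = pairsum F (map (\<lambda>r. (unit_fun r, \<lambda>q. pair_tensor L r q + c r * b q)) [0..<N])"
    by (rule pairsum_absorb[OF F]) simp
  also have "\<dots> = pairsum F (map (\<lambda>r. (unit_fun r, pair_tensor (p # L) r)) [0..<N])"
    by (simp add: p pair_tensor_def[abs_def] add.commute)
  finally show ?case .
qed

text \<open>
  Both lists have the same normal form. The Cauchy-Binet formula and the evaluation of the
  determinant below are both instances: one form is written in two ways, and the two expansions are compared.
\<close>

theorem pairsum_tensor:
  assumes "alternating N F"
    and "\<And>p q. p < N \<Longrightarrow> q < N \<Longrightarrow> pair_tensor K p q = pair_tensor L p q"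
  shows "pairsum F K = pairsum F L"
  unfolding pairsum_normal_form[OF assms(1), of K] pairsum_normal_form[OF assms(1), of L]
  by (rule pairsum_unit_rows_cong[OF assms(1)]) (simp add: assms(2))

section \<open>Sums over index sets\<close>

definition interleave :: "('i \<Rightarrow> 'v) \<Rightarrow> ('i \<Rightarrow> 'v) \<Rightarrow> 'i list \<Rightarrow> 'v list" where
  "interleave c b js = concat (map (\<lambda>j. [c j, b j]) js)"

lemma interleave_simps [simp]:
  "interleave c b [] = []" "interleave c b (j # js) = c j # b j # interleave c b js"
  "length (interleave c b js) = 2 * length js"
  by (induction js) (simp_all add: interleave_def)

text \<open>
  The sign of the permutation that sorts \<open>c\<^sub>1 b\<^sub>1 c\<^sub>2 b\<^sub>2 \<dots> c\<^sub>k b\<^sub>k\<close> into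
  \<open>c\<^sub>1 \<dots> c\<^sub>k b\<^sub>1 \<dots> b\<^sub>k\<close>, that is \<open>(-1)\<^bsup>k(k-1)/2\<^esup>\<close>: the vector \<open>b\<^sub>j\<close> moves past the \<open>k - j\<close>
  vectors \<open>c\<close> that come after it.
\<close>

definition interleave_sign :: "nat \<Rightarrow> 'a::comm_ring_1" where
  "interleave_sign k = (\<Prod>i<k. (-1) ^ i)"

lemma alternating_interleave:
  assumes "alternating N F"
  shows "F (us @ interleave c b js @ ws)
    = interleave_sign (length js) * F (us @ map c js @ map b js @ ws)"
proof (induction js arbitrary: us)
  case (Cons j js)
  have "F (us @ interleave c b (j # js) @ ws) = F ((us @ [c j, b j]) @ interleave c b js @ ws)"
    by simp
  also have "\<dots> = interleave_sign (length js) * F ((us @ [c j, b j]) @ map c js @ map b js @ ws)"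
    by (rule Cons.IH)
  also have "F ((us @ [c j, b j]) @ map c js @ map b js @ ws)
      = (-1) ^ length js * F (us @ map c (j # js) @ map b (j # js) @ ws)"
    using alternating_move[OF assms, of "us @ [c j]" "b j" "map c js"] by simp
  finally show ?case by (simp add: interleave_sign_def mult.assoc)
qed (simp add: interleave_sign_def)

lemma interleave_sign_square: "interleave_sign k * interleave_sign k = 1"
proof (induction k)
  case (Suc k)
  have "interleave_sign (Suc k) * interleave_sign (Suc k)
      = (interleave_sign k * interleave_sign k) * ((-1) ^ k * (-1) ^ k :: 'a)"
    unfolding interleave_sign_def prod.lessThan_Suc by (simp only: mult_ac)
  then show ?case by (simp add: Suc.IH)
qed (simp add: interleave_sign_def)

lemma interleave_sign_even: "interleave_sign (2 * k) = (-1) ^ k"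
  and interleave_sign_odd: "interleave_sign (2 * k + 1) = (-1) ^ k"
  by (induction k) (simp_all add: interleave_sign_def)

text \<open>
  Multiplying out \<open>\<Prod> (1 + c\<^sub>j \<and> b\<^sub>j)\<close> gives one term for each set of indices.
\<close>

lemma pairsum_index_sets:
  assumes "sorted xs" "distinct xs"
  shows "pairsum F (map (\<lambda>j. (c j, b j)) xs)
    = (\<Sum>J\<in>Pow (set xs). F (interleave c b (sorted_list_of_set J)))"
  using assms
proof (induction xs arbitrary: F)
  case (Cons x xs)
  let ?g = "\<lambda>J. F (interleave c b (sorted_list_of_set J))"
  have fresh: "x \<notin> set xs" using Cons.prems by simp
  have ins: "sorted_list_of_set (insert x J) = x # sorted_list_of_set J" if "J \<in> Pow (set xs)" for J
  proof -
    have "finite J" using that finite_subset by auto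
    moreover have "x \<notin> J" "\<forall>y\<in>J. x \<le> y" using that Cons.prems by auto
    ultimately show ?thesis by (simp add: insort_is_Cons)
  qed
  have "(\<Sum>J\<in>Pow (set (x # xs)). ?g J) = (\<Sum>J\<in>Pow (set xs). ?g J) + (\<Sum>J\<in>insert x ` Pow (set xs). ?g J)"
    unfolding list.set Pow_insert using fresh by (intro sum.union_disjoint) auto
  also have "(\<Sum>J\<in>insert x ` Pow (set xs). ?g J) = (\<Sum>J\<in>Pow (set xs). ?g (insert x J))"
    using fresh by (subst sum.reindex) (auto simp: inj_on_def)
  also have "\<dots> = (\<Sum>J\<in>Pow (set xs). F (c x # b x # interleave c b (sorted_list_of_set J)))"
    by (intro sum.cong) (simp_all add: ins)
  finally show ?case using Cons by simp
qed simp

definition index_sets :: "nat \<Rightarrow> nat \<Rightarrow> nat set set" where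
  "index_sets n k = {J. J \<subseteq> {0..<n} \<and> card J = k}"

text \<open>
  If \<open>F\<close> sees only lists of length \<open>2k\<close>, then the sign of interleaving is the same for all terms.
\<close>

lemma pairsum_index_sets_card:
  assumes "alternating N F" and "\<And>vs. length vs \<noteq> 2 * k \<Longrightarrow> F vs = 0"
  shows "pairsum F (map (\<lambda>j. (c j, b j)) [0..<n]) = interleave_sign k *
    (\<Sum>J\<in>index_sets n k. F (map c (sorted_list_of_set J) @ map b (sorted_list_of_set J)))"
proof -
  have "pairsum F (map (\<lambda>j. (c j, b j)) [0..<n])
      = (\<Sum>J\<in>Pow {0..<n}. F (interleave c b (sorted_list_of_set J)))"
    using pairsum_index_sets[of "[0..<n]" F c b] by simp
  also have "\<dots> = (\<Sum>J\<in>index_sets n k. F (interleave c b (sorted_list_of_set J)))"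
    by (rule sum.mono_neutral_right) (auto simp: index_sets_def intro!: assms(2))
  also have "\<dots> = (\<Sum>J\<in>index_sets n k. interleave_sign k *
      F (map c (sorted_list_of_set J) @ map b (sorted_list_of_set J)))"
    using alternating_interleave[OF assms(1), of "[]" c b _ "[]"]
    by (intro sum.cong) (simp_all add: index_sets_def)
  finally show ?thesis by (simp add: sum_distrib_left)
qed

section \<open>The Cauchy-Binet formula\<close>

lemma pair_tensor_map_upt: "pair_tensor (map (\<lambda>j. (c j, b j)) [0..<n]) p q = (\<Sum>j<n. c j p * b j q)"
  by (simp add: pair_tensor_def interv_sum_list_conv_sum_set_nat atLeast0LessThan comp_def)

lemma index_sets_full: "index_sets k k = {{0..<k}}"
  using card_subset_eq[of "{0..<k}"] by (auto simp: index_sets_def)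

text \<open>
  In \<open>R\<^sup>k \<oplus> R\<^sup>m\<close> the tensors \<open>\<Sum> y\<^sub>i \<otimes> a\<^sub>i\<close> and \<open>\<Sum> e\<^sub>r \<otimes> w\<^sub>r\<close> agree, where \<open>w\<^sub>r\<close> is the
  \<open>r\<close>-th combination of the \<open>a\<^sub>i\<close>. The pair sum of the first list is the left-hand side. In the second list
  there are only \<open>k\<close> pairs, so the only set of indices of size \<open>k\<close> is the full one.
  Both sides carry the same sign of interleaving.
\<close>

theorem cauchy_binet_vdet:
  fixes y a :: "nat \<Rightarrow> nat \<Rightarrow> 'a::comm_ring_1"
  shows "(\<Sum>I\<in>index_sets n k. vdet k (map y (sorted_list_of_set I)) * vdet m (map a (sorted_list_of_set I) @ ts))
    = vdet m (map (\<lambda>r q. \<Sum>i<n. y i r * a i q) [0..<k] @ ts)"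
proof -
  let ?w = "\<lambda>r q. \<Sum>i<n. y i r * a i q"
  define F where "F = (\<lambda>vs. if length vs = 2 * k then vdet (k + m) (vs @ map (embed_snd k) ts) else 0 :: 'a)"
  have F: "alternating (k + m) F"
    using alternating_context[OF alternating_vdet, of "k + m" "[]" "map (embed_snd k) ts"]
    by (auto simp: alternating_def F_def)
  have len: "length vs \<noteq> 2 * k \<Longrightarrow> F vs = 0" for vs
    by (simp add: F_def)
  have split: "F (map (\<lambda>j. embed_fst k (c j)) js @ map (\<lambda>j. embed_snd k (b j)) js) = vdet k (map c js) * vdet m (map b js @ ts)"
    if "length js = k" for c b and js :: "nat list"
    using vdet_embed_fst_snd[of k m "map c js" "map b js @ ts"] that by (simp add: F_def comp_def)
  have eval: "pairsum F (map (\<lambda>j. (embed_fst k (c j), embed_snd k (b j))) [0..<l]) = interleave_sign k *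
      (\<Sum>J\<in>index_sets l k. vdet k (map c (sorted_list_of_set J)) * vdet m (map b (sorted_list_of_set J) @ ts))"
    for c b l
  proof -
    have "(\<Sum>J\<in>index_sets l k. F (map (\<lambda>j. embed_fst k (c j)) (sorted_list_of_set J) @ map (\<lambda>j. embed_snd k (b j)) (sorted_list_of_set J)))
      = (\<Sum>J\<in>index_sets l k. vdet k (map c (sorted_list_of_set J)) * vdet m (map b (sorted_list_of_set J) @ ts))"
      by (intro sum.cong refl split) (auto simp: index_sets_def)
    then show ?thesis
      using pairsum_index_sets_card[OF F len, where c = "\<lambda>j. embed_fst k (c j)" and b = "\<lambda>j. embed_snd k (b j)" and n = l]
      by simp
  qed
  have "pairsum F (map (\<lambda>i. (embed_fst k (y i), embed_snd k (a i))) [0..<n])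
      = pairsum F (map (\<lambda>r. (embed_fst k (unit_fun r), embed_snd k (?w r))) [0..<k])"
  proof (rule pairsum_tensor[OF F])
    fix p q
    have "(\<Sum>i<n. embed_fst k (y i) p * embed_snd k (a i) q) = (\<Sum>r<k. embed_fst k (unit_fun r) p * embed_snd k (?w r) q)"
    proof (cases "p < k \<and> k \<le> q")
      case True
      then show ?thesis
        by (simp add: embed_fst_def embed_snd_def unit_fun_def if_distrib[of "\<lambda>x. x * _"] cong: if_cong)
    next
      case False
      then show ?thesis by (auto simp: embed_fst_def embed_snd_def)
    qed
    then show "pair_tensor (map (\<lambda>i. (embed_fst k (y i), embed_snd k (a i))) [0..<n]) p q
      = pair_tensor (map (\<lambda>r. (embed_fst k (unit_fun r), embed_snd k (?w r))) [0..<k]) p q"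
      by (simp only: pair_tensor_map_upt)
  qed
  then have "interleave_sign k * (interleave_sign k *
      (\<Sum>I\<in>index_sets n k. vdet k (map y (sorted_list_of_set I)) * vdet m (map a (sorted_list_of_set I) @ ts)))
    = interleave_sign k * (interleave_sign k * vdet m (map ?w [0..<k] @ ts))"
    by (simp only: eval) (simp add: index_sets_full vdet_unit_funs)
  then show ?thesis by (simp add: interleave_sign_square mult.assoc[symmetric])
qed

section \<open>The determinant as a product of two pair sums\<close>

lemma pair_tensor_append: "pair_tensor (K @ L) p q = pair_tensor K p q + pair_tensor L p q"
  by (simp add: pair_tensor_def)

lemma pair_tensor_Cons: "pair_tensor ((c, b) # L) p q = c p * b q + pair_tensor L p q"
  by (simp add: pair_tensor_def)

text \<open>
  This is the core of the proof. With the columns \<open>c\<^sub>j\<close> of \<open>A X\<close> and \<open>d\<^sub>i\<close> of \<open>B Z\<close>, the double sums over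
  \<open>x\<^sub>i\<^sub>j\<close> and \<open>z\<^sub>j\<^sub>i\<close> become single sums, and the matrix of the determinant has the entries
  \<open>M r s\<close>. The list \<open>?S\<close> is the summand \<open>\<Sum> \<delta> c\<^sub>j \<and> \<delta> b\<^sub>j\<close> that does not affect the top coefficient, and
  \<open>?T\<close> is the normal form of \<open>?U @ ?V\<close> with respect to the second summand of \<open>R\<^sup>m \<oplus> R\<^sup>m\<close>.
\<close>

lemma det_eq_sum_products:
  fixes a b c d :: "nat \<Rightarrow> nat \<Rightarrow> 'a::comm_ring_1" and x z :: "nat \<Rightarrow> nat \<Rightarrow> 'a" and m n :: nat
  assumes c: "\<And>j q. c j q = (\<Sum>i<n. x i j * a i q)"
    and d: "\<And>i q. d i q = (\<Sum>j<n. z j i * b j q)"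
    and xz: "\<And>i j. i < n \<Longrightarrow> j < n \<Longrightarrow> x i j + z j i = 1"
  defines "M \<equiv> \<lambda>r s. \<Sum>j<n. c j r * b j s + d j r * a j s"
    and "P \<equiv> map (\<lambda>j. (c j, b j)) [0..<n]" and "Q \<equiv> map (\<lambda>i. (a i, d i)) [0..<n]"
    and "sa \<equiv> \<lambda>q. \<Sum>i<n. a i q" and "sb \<equiv> \<lambda>q. \<Sum>j<n. b j q"
  shows "interleave_sign m * vdet m (map M [0..<m])
    = pairsum (vdet m) P * pairsum (vdet m) Q
      + pairsum (\<lambda>vs. vdet m (sa # vs)) P * pairsum (\<lambda>vs. vdet m (sb # vs)) Q"
proof -
  let ?F = "vdet (m + m) :: (nat \<Rightarrow> 'a) list \<Rightarrow> 'a"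
  let ?\<iota> = "embed_fst m :: (nat \<Rightarrow> 'a) \<Rightarrow> nat \<Rightarrow> 'a" and ?\<kappa> = "embed_snd m :: (nat \<Rightarrow> 'a) \<Rightarrow> nat \<Rightarrow> 'a"
    and ?\<delta> = "embed_diag m :: (nat \<Rightarrow> 'a) \<Rightarrow> nat \<Rightarrow> 'a"
  let ?S = "map (\<lambda>j. (?\<delta> (c j), ?\<delta> (b j))) [0..<n]"
  let ?T = "map (\<lambda>r. (?\<delta> (M r), ?\<kappa> (unit_fun r))) [0..<m]"
  let ?U = "map (\<lambda>j. (?\<delta> (b j), ?\<kappa> (c j))) [0..<n]"
  let ?V = "map (\<lambda>i. (?\<delta> (a i), ?\<kappa> (d i))) [0..<n]"
  let ?R = "map (map_prod ?\<iota> ?\<iota>) P @ (?\<iota> sa, ?\<kappa> sb) # map (map_prod ?\<kappa> ?\<kappa>) Q"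
  have F: "alternating (m + m) ?F" by (rule alternating_vdet)
  have delta: "?\<delta> x i = ?\<iota> x i + ?\<kappa> x i" for x i
    by (simp add: embed_diag_def embed_fst_def embed_snd_def)
  \<comment> \<open>The rows of \<open>M\<close> are what remains when \<open>c\<^sub>j\<close> and \<open>d\<^sub>i\<close> are expanded in unit vectors.\<close>
  have "pairsum ?F (?S @ ?T) = pairsum ?F (?U @ ?V @ ?S)"
  proof (rule pairsum_tensor[OF F])
    fix p q
    assume q: "q < m + m"
    have "pair_tensor ?T p q = pair_tensor ?U p q + pair_tensor ?V p q"
    proof (cases "q < m")
      case True
      then show ?thesis by (simp add: pair_tensor_map_upt embed_snd_def)
    next
      case False
      then have "?\<delta> (M (q - m)) p = (\<Sum>j<n. ?\<delta> (b j) p * c j (q - m) + ?\<delta> (a j) p * d j (q - m))"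
        by (simp add: embed_diag_def M_def mult.commute)
      with False q show ?thesis
        by (simp add: pair_tensor_map_upt embed_snd_def unit_fun_def sum.distrib
            if_distrib[of "(*) _"] cong: if_cong)
    qed
    then show "pair_tensor (?S @ ?T) p q = pair_tensor (?U @ ?V @ ?S) p q"
      by (simp add: pair_tensor_append)
  qed
  \<comment> \<open>Only with \<open>?U\<close> reversed do the tensors of the two lists agree: \<open>\<delta> c \<otimes> \<delta> b - \<kappa> c \<otimes> \<delta> b = \<iota> c \<otimes> \<delta> b\<close>.\<close>
  also have "\<dots> = pairsum ?F (map (\<lambda>(c, b). (\<lambda>i. - b i, c)) ?U @ (?V @ ?S))"
    by (rule pairsum_flip[OF F, symmetric])
  also have "\<dots> = pairsum ?F ?R"
  proof (rule pairsum_tensor[OF F])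
    fix p q
    \<comment> \<open>The mixed terms collapse to rank one; this is where \<open>x\<^sub>i\<^sub>j + z\<^sub>j\<^sub>i = 1\<close> enters.\<close>
    have one: "(\<Sum>j<n. ?\<iota> (c j) p * ?\<kappa> (b j) q) + (\<Sum>i<n. ?\<iota> (a i) p * ?\<kappa> (d i) q) = ?\<iota> sa p * ?\<kappa> sb q"
      (is "?A + ?B = ?C")
    proof (cases "p < m \<and> m \<le> q")
      case True
      let ?q = "q - m"
      have A: "?A = (\<Sum>i<n. \<Sum>j<n. x i j * (a i p * b j ?q))"
        using True by (subst sum.swap) (simp add: embed_fst_def embed_snd_def c sum_distrib_right mult.assoc)
      have B: "?B = (\<Sum>i<n. \<Sum>j<n. z j i * (a i p * b j ?q))"
        using True by (simp add: embed_fst_def embed_snd_def d sum_distrib_left mult.left_commute)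
      have "?A + ?B = (\<Sum>i<n. \<Sum>j<n. (x i j + z j i) * (a i p * b j ?q))"
        by (simp add: A B sum.distrib distrib_right)
      also have "\<dots> = (\<Sum>i<n. \<Sum>j<n. a i p * b j ?q)" by (simp add: xz)
      finally show ?thesis using True by (simp add: embed_fst_def embed_snd_def sa_def sb_def sum_product)
    next
      case False
      then show ?thesis by (auto simp: embed_fst_def embed_snd_def)
    qed
    have "pair_tensor (map (\<lambda>(c, b). (\<lambda>i. - b i, c)) ?U @ (?V @ ?S)) p q
        = (\<Sum>j<n. ?\<iota> (c j) p * ?\<delta> (b j) q) + (\<Sum>i<n. ?\<delta> (a i) p * ?\<kappa> (d i) q)"
      by (simp add: pair_tensor_append pair_tensor_map_upt comp_def delta[of "c _" p]
          distrib_right sum.distrib sum_negf)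
    also have "\<dots> = (\<Sum>j<n. ?\<iota> (c j) p * ?\<iota> (b j) q) + ?\<iota> sa p * ?\<kappa> sb q
        + (\<Sum>i<n. ?\<kappa> (a i) p * ?\<kappa> (d i) q)"
      by (simp add: delta distrib_left distrib_right sum.distrib one[symmetric])
    also have "\<dots> = pair_tensor ?R p q"
      by (simp add: P_def Q_def pair_tensor_append pair_tensor_Cons pair_tensor_map_upt comp_def)
    finally show "pair_tensor (map (\<lambda>(c, b). (\<lambda>i. - b i, c)) ?U @ (?V @ ?S)) p q = pair_tensor ?R p q" .
  qed
  also have "\<dots> = pairsum (vdet m) P * pairsum (vdet m) Q
      + pairsum (\<lambda>vs. vdet m (sa # vs)) P * pairsum (\<lambda>vs. vdet m (sb # vs)) Q"
  proof -
    have plain: "?F (map ?\<iota> us @ map ?\<kappa> vs) = vdet m us * vdet m vs" for us vs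
      by (rule vdet_embed_fst_snd)
    have mixed: "?F (map ?\<iota> us @ ?\<iota> sa # ?\<kappa> sb # map ?\<kappa> vs) = vdet m (us @ [sa]) * vdet m (sb # vs)" for us vs
      using vdet_embed_fst_snd[of m m "us @ [sa]" "sb # vs"] by simp
    \<comment> \<open>A vector can be moved past an even number of vectors without a sign.\<close>
    have front: "pairsum (\<lambda>us. vdet m (us @ [sa])) P = pairsum (\<lambda>us. vdet m (sa # us)) P"
    proof (rule pairsum_cong_even)
      fix us :: "(nat \<Rightarrow> 'a) list"
      assume "even (length us)"
      then show "vdet m (us @ [sa]) = vdet m (sa # us)"
        using alternating_move[OF alternating_vdet, of m "[]" sa us "[]"] by simp
    qed
    have "pairsum ?F ?R = pairsum (\<lambda>us. pairsum (\<lambda>vs. vdet m us * vdet m vs) Q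
        + pairsum (\<lambda>vs. vdet m (us @ [sa]) * vdet m (sb # vs)) Q) P"
      by (simp add: pairsum_append pairsum_map plain mixed)
    also have "\<dots> = pairsum (\<lambda>us. pairsum (vdet m) Q * vdet m us
        + pairsum (\<lambda>vs. vdet m (sb # vs)) Q * vdet m (us @ [sa])) P"
      unfolding pairsum_cmult by (simp only: mult.commute)
    also have "\<dots> = pairsum (vdet m) P * pairsum (vdet m) Q
        + pairsum (\<lambda>vs. vdet m (sa # vs)) P * pairsum (\<lambda>vs. vdet m (sb # vs)) Q"
      unfolding pairsum_add pairsum_cmult front by (simp only: mult.commute)
    finally show ?thesis .
  qed
  also have "pairsum ?F (?S @ ?T) = interleave_sign m * vdet m (map M [0..<m])"
  proof -
    let ?G = "\<lambda>zs. interleave_sign m * vdet m (zs @ map M [0..<m])"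
    \<comment> \<open>The second summand can be filled only by all \<open>m\<close> unit vectors, which forces the full index set.\<close>
    have inner: "pairsum (\<lambda>vs. ?F (map ?\<delta> zs @ vs)) ?T = ?G zs" for zs
    proof -
      let ?g = "\<lambda>J. ?F (map ?\<delta> zs @ interleave (\<lambda>r. ?\<delta> (M r)) (\<lambda>r. ?\<kappa> (unit_fun r)) (sorted_list_of_set J))"
      have g: "?g J = interleave_sign (card J) * (vdet m (zs @ map M (sorted_list_of_set J)) *
          vdet m (map unit_fun (sorted_list_of_set J)))" for J
        using alternating_interleave[OF F, of "map ?\<delta> zs" "\<lambda>r. ?\<delta> (M r)" "\<lambda>r. ?\<kappa> (unit_fun r)" "sorted_list_of_set J" "[]"]
          vdet_embed_diag_snd[of m "zs @ map M (sorted_list_of_set J)" "map unit_fun (sorted_list_of_set J)"]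
        by (simp add: comp_def)
      have "pairsum (\<lambda>vs. ?F (map ?\<delta> zs @ vs)) ?T = (\<Sum>J\<in>Pow {0..<m}. ?g J)"
        using pairsum_index_sets[of "[0..<m]"] by simp
      also have "\<dots> = (\<Sum>J\<in>index_sets m m. ?g J)"
        by (rule sum.mono_neutral_right) (auto simp: index_sets_def g vdet_length[of "map unit_fun _"])
      also have "\<dots> = ?G zs"
        using g[of "{0..<m}"] by (simp add: index_sets_full vdet_unit_funs)
      finally show ?thesis .
    qed
    have "?S = map (map_prod ?\<delta> ?\<delta>) P" by (simp add: P_def)
    then have "pairsum ?F (?S @ ?T) = pairsum ?G P"
      by (simp only: pairsum_append pairsum_map inner)
    \<comment> \<open>With all \<open>m\<close> rows of \<open>M\<close> present, any further vector of the diagonal is one too many.\<close>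
    also have "\<dots> = ?G []"
      by (rule pairsum_Nil_only) (simp add: vdet_length)
    finally show ?thesis by simp
  qed
  finally show ?thesis .
qed

section \<open>Signs under exchanging and reflecting the components of the pairs\<close>

text \<open>
  Each chosen pair contributes one sign. The sign stands inside the functional because the number of chosen
  pairs is not yet determined; \<open>pairsum_sign\<close> extracts it once the degree is fixed.
\<close>

lemma pairsum_exchange:
  assumes "alternating N F"
  shows "pairsum F (map (\<lambda>(c, b). (b, c)) L) = pairsum (\<lambda>vs. (-1) ^ (length vs div 2) * F vs) L"
  using assms
proof (induction L arbitrary: F)
  case (Cons p L)
  obtain c b where p: "p = (c, b)" by (cases p)
  have "F (b # c # vs) = - F (c # b # vs)" for vs
    using alternating_swap[OF Cons.prems, of "[]" b c] by simp
  then have "pairsum (\<lambda>vs. F (b # c # vs)) K = pairsum (\<lambda>vs. -1 * F (c # b # vs)) K" for K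
    by simp
  then show ?case
    using Cons.IH[OF Cons.prems] Cons.IH[OF alternating_Cons2[OF Cons.prems]]
    by (simp add: p pairsum_cmult[of "-1", simplified])
qed simp

text \<open>
  If \<open>s\<close> is already a factor in \<open>F\<close>, then the vectors \<open>s - c\<close> count as \<open>- c\<close>.
\<close>

lemma pairsum_reflect:
  assumes "alternating N F" and "\<And>us ws. F (us @ s # ws) = 0"
  shows "pairsum F (map (\<lambda>(c, b). (\<lambda>q. s q - c q, b)) L)
    = pairsum (\<lambda>vs. (-1) ^ (length vs div 2) * F vs) L"
  using assms
proof (induction L arbitrary: F)
  case (Cons p L)
  note F = Cons.prems(1)
  obtain c b where p: "p = (c, b)" by (cases p)
  have "F ((\<lambda>q. s q - c q) # vs) = - F (c # vs)" for vs
    using alternating_add[OF F, of "[]" s "\<lambda>q. - c q" vs] alternating_uminus[OF F, of "[]" c vs]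
      Cons.prems(2)[of "[]" vs] by simp
  then have "pairsum (\<lambda>vs. F ((\<lambda>q. s q - c q) # b # vs)) K = pairsum (\<lambda>vs. -1 * F (c # b # vs)) K" for K
    by simp
  moreover have "F (c # b # us @ s # ws) = 0" for us ws
    using Cons.prems(2)[of "c # b # us"] by simp
  ultimately show ?case
    using Cons.IH[OF F Cons.prems(2)] Cons.IH[OF alternating_Cons2[OF F, of c b]]
    by (simp add: p pairsum_cmult[of "-1", simplified])
qed simp

lemma pairsum_sign:
  assumes "\<And>vs. length vs \<noteq> 2 * k \<Longrightarrow> F vs = 0"
  shows "pairsum (\<lambda>vs. (-1) ^ (length vs div 2) * F vs) L = (-1) ^ k * pairsum F L"
proof -
  have "(-1) ^ (length vs div 2) * F vs = (-1) ^ k * F vs" for vs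
    using assms[of vs] by (cases "length vs = 2 * k") simp_all
  then show ?thesis by (simp add: pairsum_cmult)
qed

section \<open>Minors as determinants of lists of vectors\<close>

abbreviation (input) col_fun :: "'a mat \<Rightarrow> nat \<Rightarrow> nat \<Rightarrow> 'a" where
  "col_fun A j \<equiv> (\<lambda>q. A $$ (q, j))"

lemma pick_sorted_list_of_set:
  assumes "finite I" and "r < card I"
  shows "pick I r = sorted_list_of_set I ! r"
proof -
  let ?l = "map (pick I) [0..<card I]"
  have sorted: "sorted_wrt (<) ?l"
    by (auto simp: sorted_wrt_iff_nth_less pick_mono_le)
  then have "distinct ?l" by (simp add: strict_sorted_iff)
  then have "card (set ?l) = card I" by (metis distinct_card length_map length_upt diff_zero)
  moreover have "set ?l \<subseteq> I" using pick_in_set_le by auto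
  ultimately have "set ?l = I" using assms(1) by (simp add: card_subset_eq)
  then have "sorted_list_of_set I = ?l"
    using sorted sorted_list_of_set_unique[OF assms(1), of ?l] by simp
  then show ?thesis using assms(2) by simp
qed

lemma index_setsD:
  assumes "I \<in> index_sets n k"
  shows "finite I" "card I = k" "{i. i < n \<and> i \<in> I} = I"
    "r < k \<Longrightarrow> pick I r = sorted_list_of_set I ! r" "r < k \<Longrightarrow> sorted_list_of_set I ! r < n"
proof -
  have I: "I \<subseteq> {0..<n}" "card I = k" using assms by (simp_all add: index_sets_def)
  then show fin: "finite I" by (meson finite_atLeastLessThan finite_subset)
  show "card I = k" by fact
  show "{i. i < n \<and> i \<in> I} = I" using I by auto
  show "pick I r = sorted_list_of_set I ! r" if "r < k"
    using pick_sorted_list_of_set[OF fin] that I(2) by simp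
  show "sorted_list_of_set I ! r < n" if "r < k"
    using nth_mem[of r "sorted_list_of_set I"] that I fin by auto
qed

lemma det_append_cols_submatrix:
  assumes "A \<in> carrier_mat m n" "B \<in> carrier_mat m n"
    and I: "I \<in> index_sets n p" and J: "J \<in> index_sets n q" and "p + q = m"
  shows "det (append_cols (submatrix A UNIV I) (submatrix B UNIV J))
    = vdet m (map (col_fun A) (sorted_list_of_set I) @ map (col_fun B) (sorted_list_of_set J))"
proof -
  let ?vs = "map (col_fun A) (sorted_list_of_set I) @ map (col_fun B) (sorted_list_of_set J)"
  have "append_cols (submatrix A UNIV I) (submatrix B UNIV J) = mat m m (\<lambda>(i, j). (?vs ! j) i)"
    using assms(1,2,5) index_setsD[OF I] index_setsD[OF J]
    by (intro eq_matI) (auto simp: append_cols_def submatrix_def pick_UNIV nth_append)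
  then show ?thesis using assms(5) index_setsD[OF I] index_setsD[OF J] by (simp add: vdet_def)
qed

lemma det_submatrix:
  assumes "X \<in> carrier_mat n n" and I: "I \<in> index_sets n k" and J: "J \<in> index_sets n k"
  shows "det (submatrix X I J) = vdet k (map (\<lambda>i r. X $$ (i, sorted_list_of_set J ! r)) (sorted_list_of_set I))"
proof -
  have "submatrix X I J = mat k k (\<lambda>(i, j). ((map (\<lambda>i r. X $$ (i, sorted_list_of_set J ! r)) (sorted_list_of_set I)) ! i) j)"
    using assms(1) index_setsD[OF I] index_setsD[OF J]
    by (intro eq_matI) (auto simp: submatrix_def)
  then show ?thesis using index_setsD[OF I] by (simp add: vdet_transpose)
qed

lemma det_ones_submatrix:
  assumes "X \<in> carrier_mat n n" and I: "I \<in> index_sets n (Suc k)" and J: "J \<in> index_sets n k"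
  shows "det (append_cols (all_ones_mat (Suc k) 1) (submatrix X I J))
    = vdet (Suc k) (map (\<lambda>i r. case r of 0 \<Rightarrow> 1 | Suc r \<Rightarrow> X $$ (i, sorted_list_of_set J ! r)) (sorted_list_of_set I))"
    (is "_ = vdet _ ?vs")
proof -
  have "append_cols (all_ones_mat (Suc k) 1) (submatrix X I J) = mat (Suc k) (Suc k) (\<lambda>(i, j). (?vs ! i) j)"
    using assms(1) index_setsD[OF I] index_setsD[OF J]
    by (intro eq_matI) (auto simp: append_cols_def all_ones_mat_def submatrix_def split: nat.split)
  then show ?thesis using index_setsD[OF I] by (simp add: vdet_transpose)
qed

text \<open>
  With \<open>J\<close> outside, the inner sum over \<open>I\<close> has the shape of the Cauchy-Binet formula.
\<close>

lemma sum_index_pairs: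
  "(\<Sum>(I, J)\<in>index_pairs n p q. h I J) = (\<Sum>J\<in>index_sets n q. \<Sum>I\<in>index_sets n p. h I J)"
proof -
  have "index_pairs n p q = index_sets n p \<times> index_sets n q"
    by (auto simp: index_pairs_def index_sets_def)
  then have "(\<Sum>(I, J)\<in>index_pairs n p q. h I J) = (\<Sum>I\<in>index_sets n p. \<Sum>J\<in>index_sets n q. h I J)"
    by (simp add: sum.cartesian_product)
  then show ?thesis by (simp only: sum.swap[of _ "index_sets n p"])
qed

text \<open>
  Column \<open>j\<close> of the product \<open>A X\<close>, as a linear combination of the columns of \<open>A\<close>.
\<close>

definition mult_col :: "'a::comm_ring_1 mat \<Rightarrow> 'a mat \<Rightarrow> nat \<Rightarrow> nat \<Rightarrow> 'a" where
  "mult_col A X j = (\<lambda>q. \<Sum>i<dim_row X. X $$ (i, j) * A $$ (q, i))"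

definition row_sums :: "'a::comm_ring_1 mat \<Rightarrow> nat \<Rightarrow> 'a" where
  "row_sums A = (\<lambda>q. \<Sum>i<dim_col A. A $$ (q, i))"

lemma index_mult_mult_transpose:
  fixes U V W :: "'a::comm_ring_1 mat"
  assumes U: "U \<in> carrier_mat m n" and V: "V \<in> carrier_mat n n" and W: "W \<in> carrier_mat m n"
    and "r < m" "s < m"
  shows "(U * V * transpose_mat W) $$ (r, s) = (\<Sum>j<n. mult_col U V j r * W $$ (s, j))"
proof -
  have UV: "U * V \<in> carrier_mat m n" using U V by (rule mult_carrier_mat)
  have "(U * V * transpose_mat W) $$ (r, s) = row (U * V) r \<bullet> col (transpose_mat W) s"
    using assms(4,5) UV U W by (intro index_mult_mat(1)) simp_all
  then show ?thesis
    using assms(4,5) U V W by (simp add: scalar_prod_def mult_col_def atLeast0LessThan mult.commute)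
qed

lemma map_nth_sorted_list_of_set:
  assumes J: "J \<in> index_sets n k"
  shows "map (\<lambda>r. c (sorted_list_of_set J ! r)) [0..<k] = map c (sorted_list_of_set J)"
  by (rule nth_equalityI) (simp_all add: index_setsD[OF J])

text \<open>
  Summing over \<open>I\<close> first, the Cauchy-Binet formula replaces the columns of \<open>A\<close> by those of \<open>A X\<close>. The sum over \<open>J\<close>
  is then the expansion of a pair sum.
\<close>

theorem f_sum_eq_pairsum:
  fixes A B X :: "'a::comm_ring_1 mat"
  assumes A: "A \<in> carrier_mat m n" and B: "B \<in> carrier_mat m n" and X: "X \<in> carrier_mat n n"
    and m: "m = 2 * k"
  shows "f_sum A B X = interleave_sign k * pairsum (vdet m) (map (\<lambda>j. (mult_col A X j, col_fun B j)) [0..<n])"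
proof -
  let ?sl = sorted_list_of_set
  have inner: "(\<Sum>I\<in>index_sets n k. det (submatrix X I J) * det (append_cols (submatrix A UNIV I) (submatrix B UNIV J)))
      = vdet m (map (mult_col A X) (?sl J) @ map (col_fun B) (?sl J))" (is "?l = _")
    if J: "J \<in> index_sets n k" for J
  proof -
    have sz: "k + k = m" using m by simp
    have "?l = (\<Sum>I\<in>index_sets n k. vdet k (map (\<lambda>i r. X $$ (i, ?sl J ! r)) (?sl I))
        * vdet m (map (col_fun A) (?sl I) @ map (col_fun B) (?sl J)))"
      using sz by (intro sum.cong refl arg_cong2[where f = "(*)"] det_submatrix[OF X _ J]
          det_append_cols_submatrix[OF A B _ J])
    also have "\<dots> = vdet m (map (\<lambda>r. mult_col A X (?sl J ! r)) [0..<k] @ map (col_fun B) (?sl J))"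
      using X by (simp add: cauchy_binet_vdet mult_col_def)
    finally show ?thesis by (simp only: map_nth_sorted_list_of_set[OF J, of "mult_col A X"])
  qed
  have "f_sum A B X = (\<Sum>J\<in>index_sets n k. vdet m (map (mult_col A X) (?sl J) @ map (col_fun B) (?sl J)))"
    using A m by (simp add: f_sum_def sum_index_pairs inner)
  then show ?thesis
    using pairsum_index_sets_card[OF alternating_vdet[of m] vdet_length, where k = k and n = n
        and c = "mult_col A X" and b = "col_fun B"] m
    by (simp add: mult.assoc[symmetric] interleave_sign_square)
qed

text \<open>
  The column of ones in the minors is one more linear combination of the columns of \<open>A\<close>, the one with
  all coefficients \<open>1\<close>; the Cauchy-Binet formula turns it into the leading vector of row sums.
\<close>

theorem g_sum_eq_pairsum:
  fixes A B X :: "'a::comm_ring_1 mat"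
  assumes A: "A \<in> carrier_mat m n" and B: "B \<in> carrier_mat m n" and X: "X \<in> carrier_mat n n"
    and m: "m = 2 * k + 1"
  shows "g_sum A B X = interleave_sign k *
    pairsum (\<lambda>vs. vdet m (row_sums A # vs)) (map (\<lambda>j. (mult_col A X j, col_fun B j)) [0..<n])"
proof -
  let ?sl = sorted_list_of_set
  let ?F = "\<lambda>vs. vdet m (row_sums A # vs)"
  have inner: "(\<Sum>I\<in>index_sets n (Suc k). det (append_cols (all_ones_mat (Suc k) 1) (submatrix X I J))
        * det (append_cols (submatrix A UNIV I) (submatrix B UNIV J)))
      = ?F (map (mult_col A X) (?sl J) @ map (col_fun B) (?sl J))" (is "?l = _")
    if J: "J \<in> index_sets n k" for J
  proof -
    let ?y = "\<lambda>i r. case r of 0 \<Rightarrow> 1 | Suc r \<Rightarrow> X $$ (i, ?sl J ! r)"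
    let ?w = "\<lambda>r q. \<Sum>i<n. ?y i r * A $$ (q, i)"
    have sz: "Suc k + k = m" using m by simp
    have "?l = (\<Sum>I\<in>index_sets n (Suc k). vdet (Suc k) (map ?y (?sl I))
        * vdet m (map (col_fun A) (?sl I) @ map (col_fun B) (?sl J)))"
      using sz by (intro sum.cong refl arg_cong2[where f = "(*)"] det_ones_submatrix[OF X _ J]
          det_append_cols_submatrix[OF A B _ J])
    also have "\<dots> = vdet m (map ?w [0..<Suc k] @ map (col_fun B) (?sl J))"
      by (rule cauchy_binet_vdet)
    also have "map ?w [0..<Suc k] = row_sums A # map (\<lambda>r. mult_col A X (?sl J ! r)) [0..<k]"
      using A X by (simp add: upt_conv_Cons map_Suc_upt[symmetric] row_sums_def mult_col_def comp_def del: upt_Suc)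
    finally show ?thesis by (simp only: map_nth_sorted_list_of_set[OF J, of "mult_col A X"] append_Cons)
  qed
  have F: "alternating m ?F"
    using alternating_context[OF alternating_vdet, of m "[row_sums A]" "[]"] by simp
  have len: "?F vs = 0" if "length vs \<noteq> 2 * k" for vs
    using that m by (intro vdet_length) simp
  have "g_sum A B X = (\<Sum>J\<in>index_sets n k. ?F (map (mult_col A X) (?sl J) @ map (col_fun B) (?sl J)))"
    using A m by (simp add: g_sum_def sum_index_pairs inner[unfolded One_nat_def])
  then show ?thesis
    using pairsum_index_sets_card[OF F len, where n = n and c = "mult_col A X" and b = "col_fun B"]
    by (simp add: mult.assoc[symmetric] interleave_sign_square)
qed

section \<open>The product formulas\<close>

theorem theorem3:
  fixes A B X :: "'a::comm_ring_1 mat" and m n :: nat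
  assumes "m > 0" and "n > 0"
    and "A \<in> carrier_mat m n" and "B \<in> carrier_mat m n" and "X \<in> carrier_mat n n"
  shows "(even m \<longrightarrow>
            det (A * X * transpose_mat B
                 + B * (all_ones_mat n n - transpose_mat X) * transpose_mat A)
              = f_sum A B X * f_sum B A (all_ones_mat n n - transpose_mat X))
       \<and> (odd m \<longrightarrow>
            det (A * X * transpose_mat B
                 + B * (all_ones_mat n n - transpose_mat X) * transpose_mat A)
              = g_sum A B X * g_sum B A (all_ones_mat n n - transpose_mat X)
          \<and> g_sum A B X * g_sum B A (all_ones_mat n n - transpose_mat X)
              = (- 1) ^ ((m - 1) div 2) * g_sum A B X * g_sum B A (transpose_mat X))"
proof -
  note A = assms(3) and B = assms(4) and X = assms(5)
  define Z :: "'a mat" where "Z = all_ones_mat n n - transpose_mat X"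
  have Z: "Z \<in> carrier_mat n n" and XT: "transpose_mat X \<in> carrier_mat n n"
    using X by (auto simp: Z_def all_ones_mat_def)
  have entry: "Z $$ (j, i) = 1 - X $$ (i, j)" if "i < n" "j < n" for i j
    using that X by (simp add: Z_def all_ones_mat_def)
  let ?P = "map (\<lambda>j. (mult_col A X j, col_fun B j)) [0..<n]"
  let ?Q = "map (\<lambda>i. (col_fun A i, mult_col B Z i)) [0..<n]"
  let ?Q' = "map (\<lambda>i. (mult_col B Z i, col_fun A i)) [0..<n]"
  let ?D = "det (A * X * transpose_mat B + B * Z * transpose_mat A)"
  let ?M = "\<lambda>r s. \<Sum>j<n. mult_col A X j r * col_fun B j s + mult_col B Z j r * col_fun A j s"
  have "A * X * transpose_mat B + B * Z * transpose_mat A = mat m m (\<lambda>(i, j). (map ?M [0..<m] ! i) j)"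
    using A B X Z index_mult_mult_transpose[OF A X B] index_mult_mult_transpose[OF B Z A]
    by (intro eq_matI) (simp_all add: sum.distrib del: index_mult_mat(1) assoc_mult_mat)
  then have D: "?D = vdet m (map ?M [0..<m])" by (simp add: vdet_transpose)
  have core: "interleave_sign m * ?D = pairsum (vdet m) ?P * pairsum (vdet m) ?Q
      + pairsum (\<lambda>vs. vdet m (row_sums A # vs)) ?P * pairsum (\<lambda>vs. vdet m (row_sums B # vs)) ?Q"
    unfolding D
    using det_eq_sum_products[where n = n and m = m and a = "col_fun A" and b = "col_fun B"
        and c = "mult_col A X" and d = "mult_col B Z"
        and x = "\<lambda>i j. X $$ (i, j)" and z = "\<lambda>j i. Z $$ (j, i)"] A B X Z
    by (simp add: mult_col_def row_sums_def entry)
  \<comment> \<open>Exchanging the components makes the second factor a sum for \<open>B\<close>, \<open>A\<close> at the price of \<open>(-1)\<^sup>k\<close> with \<open>k = m div 2\<close>,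
      which is also the sign of interleaving \<open>m\<close> pairs; the two signs cancel.\<close>
  have exchange: "?Q = map (\<lambda>(c, b). (b, c)) ?Q'" by simp
  have even_case: "?D = f_sum A B X * f_sum B A Z" if even: "even m"
  proof -
    obtain k where k: "m = 2 * k" using even by (rule evenE)
    have sign: "interleave_sign m = ((-1) ^ k :: 'a)" unfolding k by (rule interleave_sign_even)
    have "pairsum (\<lambda>vs. vdet m (row_sums A # vs)) ?P = 0"
      by (rule pairsum_odd, rule vdet_length) (use even in auto)
    moreover have "pairsum (vdet m) ?Q = (-1) ^ k * pairsum (vdet m) ?Q'"
      unfolding exchange pairsum_exchange[OF alternating_vdet]
      by (rule pairsum_sign) (simp add: vdet_length k)
    ultimately have "(-1) ^ k * ?D = (-1) ^ k * (pairsum (vdet m) ?P * pairsum (vdet m) ?Q')"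
      using core by (simp add: sign mult.left_commute)
    then have "(-1) ^ k * ((-1) ^ k * ?D) = (-1) ^ k * ((-1) ^ k * (pairsum (vdet m) ?P * pairsum (vdet m) ?Q'))"
      by (rule arg_cong)
    then have "?D = pairsum (vdet m) ?P * pairsum (vdet m) ?Q'" by simp
    also have "\<dots> = (interleave_sign k * interleave_sign k) * (pairsum (vdet m) ?P * pairsum (vdet m) ?Q')"
      by (simp add: interleave_sign_square)
    also have "\<dots> = f_sum A B X * f_sum B A Z"
      unfolding f_sum_eq_pairsum[OF A B X k] f_sum_eq_pairsum[OF B A Z k] by (simp only: mult_ac)
    finally show ?thesis .
  qed
  have odd_case: "?D = g_sum A B X * g_sum B A Z \<and>
      g_sum A B X * g_sum B A Z = (- 1) ^ ((m - 1) div 2) * g_sum A B X * g_sum B A (transpose_mat X)"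
    if odd: "odd m"
  proof
    obtain k where k: "m = 2 * k + 1" using odd by (rule oddE)
    have sign: "interleave_sign m = ((-1) ^ k :: 'a)" unfolding k by (rule interleave_sign_odd)
    let ?F = "\<lambda>vs. vdet m (row_sums A # vs)" and ?G = "\<lambda>vs. vdet m (row_sums B # vs)"
    have G: "alternating m ?G"
      using alternating_context[OF alternating_vdet, of m "[row_sums B]" "[]"] by simp
    have len: "?G vs = 0" if "length vs \<noteq> 2 * k" for vs
      using that k by (intro vdet_length) simp
    have "pairsum (vdet m) ?P = 0"
      by (rule pairsum_odd, rule vdet_length) (use odd in auto)
    moreover have "pairsum ?G ?Q = (-1) ^ k * pairsum ?G ?Q'"
      unfolding exchange pairsum_exchange[OF G] by (rule pairsum_sign) (rule len)
    ultimately have "(-1) ^ k * ?D = (-1) ^ k * (pairsum ?F ?P * pairsum ?G ?Q')"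
      using core by (simp add: sign mult.left_commute)
    then have "(-1) ^ k * ((-1) ^ k * ?D) = (-1) ^ k * ((-1) ^ k * (pairsum ?F ?P * pairsum ?G ?Q'))"
      by (rule arg_cong)
    then have "?D = pairsum ?F ?P * pairsum ?G ?Q'" by simp
    also have "\<dots> = (interleave_sign k * interleave_sign k) * (pairsum ?F ?P * pairsum ?G ?Q')"
      by (simp add: interleave_sign_square)
    also have "\<dots> = g_sum A B X * g_sum B A Z"
      unfolding g_sum_eq_pairsum[OF A B X k] g_sum_eq_pairsum[OF B A Z k] by (simp only: mult_ac)
    finally show "?D = g_sum A B X * g_sum B A Z" .
    let ?R = "map (\<lambda>i. (mult_col B (transpose_mat X) i, col_fun A i)) [0..<n]"
    have "mult_col B Z i = (\<lambda>q. row_sums B q - mult_col B (transpose_mat X) i q)" if "i < n" for i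
      using that B X Z by (simp add: mult_col_def row_sums_def entry left_diff_distrib sum_subtractf fun_eq_iff)
    then have reflect: "?Q' = map (\<lambda>(c, b). (\<lambda>q. row_sums B q - c q, b)) ?R" by simp
    have kill: "?G (us @ row_sums B # ws) = 0" for us ws
      using alternating_repeat[OF alternating_vdet, of m "[]" "row_sums B" us ws] by simp
    have "pairsum ?G ?Q' = pairsum (\<lambda>vs. (-1) ^ (length vs div 2) * ?G vs) ?R"
      unfolding reflect by (rule pairsum_reflect[OF G kill])
    also have "\<dots> = (-1) ^ k * pairsum ?G ?R"
      by (rule pairsum_sign) (rule len)
    finally have "pairsum ?G ?Q' = (-1) ^ k * pairsum ?G ?R" .
    then have "g_sum B A Z = (-1) ^ k * g_sum B A (transpose_mat X)"
      unfolding g_sum_eq_pairsum[OF B A Z k] g_sum_eq_pairsum[OF B A XT k] by (simp only: mult_ac)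
    then show "g_sum A B X * g_sum B A Z = (- 1) ^ ((m - 1) div 2) * g_sum A B X * g_sum B A (transpose_mat X)"
      by (simp add: k mult_ac)
  qed
  show ?thesis using even_case odd_case unfolding Z_def by blast
qed

end
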